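(* Let $d\ge1$, $s\in(1,2)$, $\varepsilon>0$ and $x_0\in\mathbb{R}^d$. Assume $u:\mathbb{R}^d\to\mathbb{R}$ is convex and $C^{1,1}$, that $\mathrm{MA}_s u$ is bounded in a neighborhood of $x_0$, and that the section $D_{x_0}u(\varepsilon)$ has diameter $\Lambda<+\infty$. Then $\mathrm{MA}_s u$ is H\"older continuous of class $C^{1-s/2}$ in a neighborhood of $x_0$.
   Context: $C^{1,1}$ means differentiable with globally Lipschitz gradient. For $u\in C^1$ and $t>0$, the section of $u$ at $x$ is $$D_xu(t)=\{y\in\mathbb{R}^d: u(y)-u(x)-(y-x)\cdot\nabla u(x)\le t\}.$$ An admissible kernel is a measurable function $K:\mathbb{R}^d\to[0,\infty]$ such that $|\{y:K(y)>r^{-d-s}\}|=|B_r|$ for every $r>0$. For convex $u\in C^1$, $$\mathrm{MA}_s u(x)=\inf_{K\text{ admissible}}\int_{\mathbb{R}^d}\big(u(x+y)-u(x)-y\cdot\nabla u(x)\big)K(y)\,dy\in[0,+\infty].$$ *)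

theory Defs
  imports "HOL-Analysis.Analysis"
begin

definition gradient :: "('a::euclidean_space \<Rightarrow> real) \<Rightarrow> 'a \<Rightarrow> 'a" where
  "gradient u x = (THE g. GDERIV u x :> g)"

definition C11 :: "('a::euclidean_space \<Rightarrow> real) \<Rightarrow> bool" where
  "C11 u \<longleftrightarrow> (\<forall>x. u differentiable (at x)) \<and> (\<exists>L. L-lipschitz_on UNIV (gradient u))"

definition graph_section :: "('a::euclidean_space \<Rightarrow> real) \<Rightarrow> 'a \<Rightarrow> real \<Rightarrow> 'a set" where
  "graph_section u x t = {y. u y - u x - (y - x) \<bullet> gradient u x \<le> t}"

definition admissible_kernel :: "real \<Rightarrow> ('a::euclidean_space \<Rightarrow> ennreal) \<Rightarrow> bool" where
  "admissible_kernel s K \<longleftrightarrow>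
     K \<in> borel_measurable lebesgue \<and>
     (\<forall>r>0. emeasure lebesgue {y. K y > ennreal (r powr (- real DIM('a) - s))}
            = emeasure lebesgue (ball (0::'a) r))"

text \<open>For convex differentiable \<open>u\<close> the increment below is nonnegative, so the embedding
  \<open>ennreal\<close>, which sends negative reals to 0, does not alter the integrand.\<close>

definition MA :: "real \<Rightarrow> ('a::euclidean_space \<Rightarrow> real) \<Rightarrow> 'a \<Rightarrow> ennreal" where
  "MA s u x = (INF K\<in>{K. admissible_kernel s K}.
     \<integral>\<^sup>+ y. ennreal (u (x + y) - u x - y \<bullet> gradient u x) * K y \<partial>lebesgue)"

definition holder_on :: "real \<Rightarrow> 'a::metric_space set \<Rightarrow> ('a \<Rightarrow> real) \<Rightarrow> bool" where
  "holder_on \<alpha> S f \<longleftrightarrow>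
     (\<exists>C\<ge>0. \<forall>x\<in>S. \<forall>y\<in>S. \<bar>f x - f y\<bar> \<le> C * dist x y powr \<alpha>)"

end

theory Submission
  imports Defs
begin

text \<open>
  Write \<open>v\<^sub>x(p) = u(p) - u(x) - (p - x) \<bullet> \<nabla>u(x)\<close>. For \<open>x, z\<close> near \<open>x0\<close> with \<open>\<delta> = |x - z| > 0\<close>, boundedness
  of one section makes \<open>v\<^sub>z\<close> grow at least linearly, so the Lipschitz bound on the gradient gives
  \<open>V(p - x) := v\<^sub>x(p) + \<delta> min(|p - x|, |p - x|\<^sup>2) \<le> v\<^sub>z(p) + C \<delta> (1 + v\<^sub>z(p))\<close>.
  The added term makes \<open>{V = 0}\<close> a point while costing only \<open>O(\<delta>)\<close>; since \<open>V(l y) \<le> l V(y)\<close> for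
  \<open>0 \<le> l \<le> 1\<close>, the volume of \<open>{V \<le> t}\<close> is continuous in \<open>t\<close>, and there is an admissible kernel
  \<open>K\<close> whose superlevel sets are sublevel sets of \<open>V\<close>. By the bathtub principle \<open>K\<close> minimises
  \<open>\<integral>\<phi>(V) K\<close> for every increasing \<open>\<phi>\<close> at once. Split \<open>V = min(V, C\<delta>) + (V - C\<delta>)\<^sub>+\<close>: comparing the first
  term with balls bounds it by a multiple of \<open>\<delta>\<close> to the power \<open>1 - s/2\<close>, and comparing the second
  with any translated competitor for \<open>z\<close> bounds it by \<open>(1 + C\<delta>) MA\<^sub>s u(z)\<close>.
\<close>


section \<open>Layer cake formula, bathtub principle, Borel versions of kernels\<close>

lemma nn_integral_layer_cake:
  fixes f K :: "'a::euclidean_space \<Rightarrow> ennreal"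
  assumes [measurable]: "f \<in> borel_measurable borel" "K \<in> borel_measurable borel"
  shows "(\<integral>\<^sup>+y. f y * K y \<partial>lborel) =
    (\<integral>\<^sup>+\<tau>. (\<integral>\<^sup>+y. f y * indicator {y. ennreal \<tau> < K y} y \<partial>lborel) * indicator {0<..} \<tau> \<partial>lborel)"
proof -
  \<comment> \<open>Each value is the length of the interval below it. This turns the product into a
    double integral, whose order is then exchanged.\<close>
  have height: "(\<integral>\<^sup>+\<tau>. indicator {0<..} \<tau> * indicator {\<tau>. ennreal \<tau> < k} \<tau> \<partial>lborel) = k" for k
  proof (cases k)
    case (real q)
    then have "(\<integral>\<^sup>+\<tau>. indicator {0<..} \<tau> * indicator {\<tau>. ennreal \<tau> < k} \<tau> \<partial>lborel)
       = (\<integral>\<^sup>+\<tau>. indicator {0<..<q} \<tau> \<partial>lborel)"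
      by (intro nn_integral_cong) (auto simp: indicator_def ennreal_less_iff)
    then show ?thesis using real by simp
  next
    case top
    have "emeasure lborel {0::real<..} = \<infinity>"
    proof (rule ccontr)
      assume "emeasure lborel {0::real<..} \<noteq> \<infinity>"
      then obtain q where q: "emeasure lborel {0::real<..} = ennreal q" "q \<ge> 0"
        by (cases "emeasure lborel {0::real<..}") auto
      have "ennreal (q + 1) = emeasure lborel {0<..<q + 1}" using q by simp
      also have "\<dots> \<le> emeasure lborel {0::real<..}" by (rule emeasure_mono) auto
      finally show False using q by (simp add: ennreal_le_iff)
    qed
    then show ?thesis using top by (simp flip: indicator_inter_arith)
  qed
  have "(\<integral>\<^sup>+y. f y * K y \<partial>lborel) =
     (\<integral>\<^sup>+y. f y * (\<integral>\<^sup>+\<tau>. indicator {0<..} \<tau> * indicator {\<tau>. ennreal \<tau> < K y} \<tau> \<partial>lborel) \<partial>lborel)"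
    by (simp only: height)
  also have "\<dots> = (\<integral>\<^sup>+y. (\<integral>\<^sup>+\<tau>. f y * (indicator {0<..} \<tau> * indicator {\<tau>. ennreal \<tau> < K y} \<tau>) \<partial>lborel) \<partial>lborel)"
    by (intro nn_integral_cong nn_integral_cmult[symmetric]) measurable
  also have "\<dots> = (\<integral>\<^sup>+\<tau>. (\<integral>\<^sup>+y. f y * (indicator {0<..} \<tau> * indicator {\<tau>. ennreal \<tau> < K y} \<tau>) \<partial>lborel) \<partial>lborel)"
    by (intro lborel_pair.Fubini'[symmetric]) measurable
  also have "\<dots> = (\<integral>\<^sup>+\<tau>. (\<integral>\<^sup>+y. f y * indicator {y. ennreal \<tau> < K y} y \<partial>lborel) * indicator {0<..} \<tau> \<partial>lborel)"
    by (intro nn_integral_cong) (auto simp: indicator_def intro!: nn_integral_cong)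
  finally show ?thesis .
qed

text \<open>The common part \<open>E \<inter> E'\<close> cancels because its measure is finite, so
  \<open>E - E'\<close> and \<open>E' - E\<close> have equal measure. On the first \<open>f\<close>
  is at most \<open>c\<close>, on the second at least \<open>c\<close>.\<close>

lemma nn_integral_bathtub:
  fixes f :: "'a \<Rightarrow> ennreal"
  assumes [measurable]: "f \<in> borel_measurable M" "E \<in> sets M" "E' \<in> sets M"
    and eq: "emeasure M E = emeasure M E'" and fin: "emeasure M E < \<infinity>"
    and le: "\<And>x. x \<in> E \<Longrightarrow> f x \<le> c" and ge: "\<And>x. x \<in> space M \<Longrightarrow> x \<notin> E \<Longrightarrow> c \<le> f x"
  shows "(\<integral>\<^sup>+x. f x * indicator E x \<partial>M) \<le> (\<integral>\<^sup>+x. f x * indicator E' x \<partial>M)"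
proof -
  have "emeasure M (E \<inter> E') + emeasure M (E - E') = emeasure M (E' \<inter> E) + emeasure M (E' - E)"
    using eq by (simp only: plus_emeasure assms sets.Int sets.Diff Int_Diff_disjoint Int_Diff_Un)
  moreover have "emeasure M (E \<inter> E') < \<infinity>"
    using fin by (meson Int_lower1 assms(2) emeasure_mono order_le_less_trans)
  ultimately have diff: "emeasure M (E - E') = emeasure M (E' - E)"
    by (auto simp: Int_commute ennreal_add_left_cancel)
  have "(\<integral>\<^sup>+x. f x * indicator E x \<partial>M)
     = (\<integral>\<^sup>+x. f x * indicator (E \<inter> E') x + f x * indicator (E - E') x \<partial>M)"
    by (intro nn_integral_cong) (simp split: split_indicator)
  also have "\<dots> = (\<integral>\<^sup>+x. f x * indicator (E \<inter> E') x \<partial>M) + (\<integral>\<^sup>+x. f x * indicator (E - E') x \<partial>M)"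
    by (rule nn_integral_add) measurable
  also have "(\<integral>\<^sup>+x. f x * indicator (E - E') x \<partial>M) \<le> (\<integral>\<^sup>+x. c * indicator (E - E') x \<partial>M)"
    by (intro nn_integral_mono) (auto simp: le split: split_indicator)
  also have "\<dots> = (\<integral>\<^sup>+x. c * indicator (E' - E) x \<partial>M)"
    by (simp add: nn_integral_cmult diff)
  also have "\<dots> \<le> (\<integral>\<^sup>+x. f x * indicator (E' - E) x \<partial>M)"
    by (intro nn_integral_mono) (auto simp: ge split: split_indicator)
  also have "(\<integral>\<^sup>+x. f x * indicator (E \<inter> E') x \<partial>M) + \<dots>
     = (\<integral>\<^sup>+x. f x * indicator (E \<inter> E') x + f x * indicator (E' - E) x \<partial>M)"
    by (rule nn_integral_add[symmetric]) measurable
  also have "\<dots> = (\<integral>\<^sup>+x. f x * indicator E' x \<partial>M)"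
    by (intro nn_integral_cong) (simp split: split_indicator)
  finally show ?thesis by (simp add: add_left_mono)
qed

text \<open>Admissibility sees only the measures of superlevel sets, so it survives a change on a
  null set. The layer cake formula and the translation of kernels are stated for Borel
  functions.\<close>

lemma admissible_kernel_borel_version:
  fixes K :: "'a::euclidean_space \<Rightarrow> ennreal"
  assumes "admissible_kernel s K"
  obtains K' where "K' \<in> borel_measurable borel" "admissible_kernel s K'" "AE y in lborel. K y = K' y"
proof -
  have K: "K \<in> borel_measurable lebesgue" using assms unfolding admissible_kernel_def by blast
  obtain K' where K': "K' \<in> borel_measurable lborel" "AE y in lborel. K y = K' y"
    using completion_ex_borel_measurable[OF K] by auto
  have K'm: "K' \<in> borel_measurable lebesgue" using K'(1) by (rule measurable_completion)
  have "emeasure lebesgue {y. K' y > c} = emeasure lebesgue {y. K y > c}" for c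
  proof (rule emeasure_eq_AE)
    show "AE x in lebesgue. (x \<in> {y. c < K' y}) = (x \<in> {y. c < K y})"
      using AE_completion[OF K'(2)] by eventually_elim auto
    show "{y. c < K' y} \<in> sets lebesgue" "{y. c < K y} \<in> sets lebesgue"
      using measurable_sets[OF K'm, of "{c<..}"] measurable_sets[OF K, of "{c<..}"]
      by (simp_all add: vimage_def)
  qed
  then have "admissible_kernel s K'"
    using assms K'm unfolding admissible_kernel_def by metis
  with K' that show thesis by auto
qed

text \<open>Admissibility is phrased by radii, the layer cake formula by heights. This radius turns
  any height \<open>\<tau> > 0\<close> into the form \<open>r powr (- d - s)\<close>.\<close>

lemma powr_radius:
  fixes d s \<tau> :: real
  assumes "0 < d" "0 < s" "0 < \<tau>"
  shows "(\<tau> powr (- 1 / (d + s))) powr (- d - s) = \<tau>"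
proof -
  have "- 1 / (d + s) * (- d - s) = 1"
    using assms by (simp add: field_simps)
  then show ?thesis using assms by (simp only: powr_powr) simp
qed

section \<open>Volumes of the sublevel sets of a star-shaped function\<close>

text \<open>\<open>star\<close> takes the place of convexity, which the term
  \<open>min (norm y) ((norm y)\<^sup>2)\<close> would destroy. \<open>lower\<close> makes sublevel
  sets bounded and shrinks them to the origin; its constant \<open>a\<close> enters no later
  estimate, so it may be as small as the distance of two points. \<open>upper\<close> permits
  comparison with balls.\<close>

locale starshaped_growth =
  fixes V :: "'a::euclidean_space \<Rightarrow> real" and a B :: real
  assumes borel_V [measurable]: "V \<in> borel_measurable borel"
    and star: "\<And>l y. 0 \<le> l \<Longrightarrow> l \<le> 1 \<Longrightarrow> V (l *\<^sub>R y) \<le> l * V y"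
    and lower: "\<And>y. a * min (norm y) ((norm y)\<^sup>2) \<le> V y" and a_pos: "a > 0"
    and upper: "\<And>y. V y \<le> B * (norm y)\<^sup>2" and B_pos: "B > 0"
begin

definition F :: "real \<Rightarrow> real" where
  "F t = measure lborel {y. V y \<le> t}"

lemma V_nonneg: "0 \<le> V y"
  using lower[of y] a_pos by (smt (verit) min_def mult_nonneg_nonneg norm_ge_zero zero_le_power2)

lemma V_zero: "V 0 = 0"
  using upper[of 0] V_nonneg[of 0] by simp

lemma V_pos: "y \<noteq> 0 \<Longrightarrow> 0 < V y"
  using lower[of y] a_pos by (smt (verit) min_def mult_pos_pos zero_less_norm_iff zero_less_power)

text \<open>Outside the unit ball the lower bound is linear, which gives the radius
  \<open>\<bar>t\<bar> / a\<close>; the summand 1 covers the unit ball.\<close>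

lemma sublevel_bounded: "{y. V y \<le> t} \<subseteq> cball 0 (\<bar>t\<bar> / a + 1)"
proof
  fix y assume y: "y \<in> {y. V y \<le> t}"
  show "y \<in> cball 0 (\<bar>t\<bar> / a + 1)"
  proof (cases "norm y \<le> 1")
    case True
    then show ?thesis using a_pos by (simp add: add_increasing)
  next
    case False
    then have "norm y \<le> (norm y)\<^sup>2" using self_le_power[of "norm y" 2] by simp
    then have "min (norm y) ((norm y)\<^sup>2) = norm y" by (rule min_absorb1)
    then have "a * norm y \<le> t" using lower[of y] y by simp
    then have "norm y \<le> \<bar>t\<bar> / a" using a_pos by (simp add: field_simps)
    then show ?thesis by simp
  qed
qed

lemma sublevel_fmeasurable: "A \<in> sets borel \<Longrightarrow> A \<subseteq> {y. V y \<le> t} \<Longrightarrow> A \<in> fmeasurable lborel"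
  by (rule fmeasurableI2[of "cball 0 (\<bar>t\<bar> / a + 1)"])
     (use sublevel_bounded[of t] in \<open>auto intro: fmeasurableI emeasure_lborel_cball_finite\<close>)

lemma sublevel_sets [measurable]: "{y. V y \<le> t} \<in> sets borel" "{y. V y < t} \<in> sets borel"
  by measurable

lemma F_mono: "t \<le> t' \<Longrightarrow> F t \<le> F t'"
  unfolding F_def by (rule measure_mono_fmeasurable) (auto intro: sublevel_fmeasurable[of _ t'])

lemma F_borel [measurable]: "F \<in> borel_measurable borel"
  by (rule borel_measurable_mono) (auto simp: mono_def F_mono)

text \<open>By \<open>star\<close>, shrinking \<open>{V <= t}\<close> by the factor \<open>l\<close>
  lands inside \<open>{V <= l * t}\<close>. This is the quantitative fact that forbids jumps of
  \<open>F\<close> at positive levels.\<close>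

lemma F_scale:
  assumes "0 < l" "l \<le> 1"
  shows "l ^ DIM('a) * F t \<le> F (l * t)"
proof -
  let ?S = "{y. V y \<le> t}"
  have sub: "(\<lambda>y. l *\<^sub>R y + 0) ` ?S \<subseteq> {y. V y \<le> l * t}"
    using star[of l] assms by (auto intro!: order_trans[OF star mult_left_mono])
  have "l ^ DIM('a) * F t = measure lebesgue ((\<lambda>y. l *\<^sub>R y + 0) ` ?S)"
    using assms by (subst measure_lebesgue_affine) (simp add: F_def measure_completion)
  also have "\<dots> \<le> measure lebesgue {y. V y \<le> l * t}"
  proof (rule measure_mono_fmeasurable[OF sub])
    \<comment> \<open>Measurability of the image is read off from its form as a preimage.\<close>
    have "(\<lambda>y. l *\<^sub>R y + 0) ` ?S = {y. V ((1 / l) *\<^sub>R y) \<le> t}"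
    proof safe
      fix y assume "V ((1 / l) *\<^sub>R y) \<le> t"
      then show "y \<in> (\<lambda>y. l *\<^sub>R y + 0) ` ?S"
        using assms by (intro image_eqI[of _ _ "(1 / l) *\<^sub>R y"]) auto
    qed (use assms in simp)
    moreover have "{y. V ((1 / l) *\<^sub>R y) \<le> t} \<in> sets borel" by measurable
    ultimately show "(\<lambda>y. l *\<^sub>R y + 0) ` ?S \<in> sets lebesgue"
      by (simp add: sets_completionI_sets)
    show "{y. V y \<le> l * t} \<in> lmeasurable"
      using sublevel_fmeasurable[of "{y. V y \<le> l * t}" "l * t"] by (simp add: fmeasurable_def)
  qed
  also have "\<dots> = F (l * t)" by (simp add: F_def measure_completion)
  finally show ?thesis .
qed

lemma F_ge_ball:
  assumes "r > 0" shows "unit_ball_vol (real DIM('a)) * r ^ DIM('a) \<le> F (B * r\<^sup>2)"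
proof -
  have "unit_ball_vol (real DIM('a)) * r ^ DIM('a) = measure lborel (ball (0::'a) r)"
    using assms by (simp add: content_ball)
  also have "\<dots> \<le> F (B * r\<^sup>2)" unfolding F_def
  proof (rule measure_mono_fmeasurable)
    show "ball 0 r \<subseteq> {y. V y \<le> B * r\<^sup>2}"
    proof
      fix y :: 'a assume "y \<in> ball 0 r"
      then have "B * (norm y)\<^sup>2 \<le> B * r\<^sup>2" using B_pos by (simp add: power_mono)
      then show "y \<in> {y. V y \<le> B * r\<^sup>2}" using upper[of y] by simp
    qed
  qed (auto intro: sublevel_fmeasurable)
  finally show ?thesis .
qed

lemma F_pos:
  assumes "t > 0" shows "F t > 0"
proof -
  define r where "r = sqrt (t / B)"
  have "r > 0" "B * r\<^sup>2 = t" using assms B_pos by (simp_all add: r_def)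
  then show ?thesis
    using F_ge_ball[of r] by (smt (verit) mult_pos_pos of_nat_0_le_iff unit_ball_vol_pos zero_less_power)
qed

text \<open>For \<open>\<rho> < 1\<close> the quadratic part of the lower bound confines
  \<open>{V <= a * \<rho>^2}\<close> to the ball of radius \<open>\<rho>\<close>, so
  \<open>F\<close> becomes arbitrarily small at positive levels.\<close>

lemma F_small:
  assumes "r > 0" shows "\<exists>t>0. F t < unit_ball_vol (real DIM('a)) * r ^ DIM('a)"
proof -
  define \<rho> where "\<rho> = min (r / 2) (1 / 2)"
  have \<rho>: "0 < \<rho>" "\<rho> < r" "\<rho> < 1" using assms by (auto simp: \<rho>_def min_def)
  have "{y. V y \<le> a * \<rho>\<^sup>2} \<subseteq> cball 0 \<rho>"
  proof
    fix y assume "y \<in> {y. V y \<le> a * \<rho>\<^sup>2}"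
    then have "a * min (norm y) ((norm y)\<^sup>2) \<le> a * \<rho>\<^sup>2" using lower[of y] by simp
    then have m: "min (norm y) ((norm y)\<^sup>2) \<le> \<rho>\<^sup>2" using a_pos by simp
    have "\<rho>\<^sup>2 \<le> \<rho>" using \<rho> by (simp add: power2_eq_square mult_left_le)
    then have "norm y \<le> \<rho>" using m \<rho> by (auto simp: min_def split: if_splits intro: power2_le_imp_le)
    then show "y \<in> cball 0 \<rho>" by simp
  qed
  then have "F (a * \<rho>\<^sup>2) \<le> measure lborel (cball (0::'a) \<rho>)"
    unfolding F_def by (intro measure_mono_fmeasurable)
      (auto intro: fmeasurableI emeasure_lborel_cball_finite)
  also have "\<dots> = unit_ball_vol (real DIM('a)) * \<rho> ^ DIM('a)"
    using \<rho> by (simp add: content_cball)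
  also have "\<dots> < unit_ball_vol (real DIM('a)) * r ^ DIM('a)"
    using \<rho> by (intro mult_strict_left_mono power_strict_mono) auto
  finally show ?thesis using \<rho> a_pos by (intro exI[of _ "a * \<rho>\<^sup>2"]) simp
qed

text \<open>The set is \<open>{V < t0}\<close>, possibly together with \<open>{V = t0}\<close>, for
  the critical level \<open>t0\<close>. A jump of \<open>F\<close> at \<open>t0\<close> could make
  its volume miss \<open>c\<close>; \<open>F_scale\<close> with \<open>l\<close> tending to 1
  excludes that.\<close>

lemma rank_sublevel:
  assumes "r > 0"
  defines "c \<equiv> unit_ball_vol (real DIM('a)) * r ^ DIM('a)"
  shows "emeasure lborel {y. F (V y) < c} = ennreal c"
    and "\<exists>t. {y. V y < t} \<subseteq> {y. F (V y) < c} \<and> {y. F (V y) < c} \<subseteq> {y. V y \<le> t}"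
proof -
  let ?E = "{y. F (V y) < c}" let ?T = "{t. F t < c}"
  have E: "?E \<in> sets borel" by measurable
  obtain t1 where t1: "t1 > 0" "F t1 < c" using F_small[OF assms(1)] by (auto simp: c_def)
  have bound: "t \<le> B * r\<^sup>2" if "F t < c" for t
    using F_ge_ball[OF assms(1)] F_mono[of "B * r\<^sup>2" t] that by (force simp: c_def)
  then have bdd: "bdd_above ?T" by (intro bdd_aboveI[of _ "B * r\<^sup>2"]) simp
  \<comment> \<open>The critical level: \<open>F < c\<close> below it and \<open>F >= c\<close>
    above it. The value at \<open>t0\<close> itself is settled by the limits that follow.\<close>
  define t0 where "t0 = Sup ?T"
  have t0: "t0 > 0" using cSup_upper[OF _ bdd, of t1] t1 by (simp add: t0_def)
  have below: "F t < c" if "t < t0" for t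
  proof -
    obtain t' where "F t' < c" "t < t'"
      using less_cSupD[of ?T t] \<open>t < t0\<close> t1 unfolding t0_def by auto
    then show ?thesis using F_mono[of t t'] by simp
  qed
  have above: "c \<le> F t" if "t > t0" for t
    using cSup_upper[OF _ bdd, of t] that unfolding t0_def by (metis mem_Collect_eq not_le)
  have sub: "{y. V y < t0} \<subseteq> ?E" "?E \<subseteq> {y. V y \<le> t0}"
    using below above by (auto simp: not_le[symmetric])
  then show "\<exists>t. {y. V y < t} \<subseteq> ?E \<and> ?E \<subseteq> {y. V y \<le> t}" by blast
  have m: "?E \<in> fmeasurable lborel" "{y. V y < t0} \<in> fmeasurable lborel"
    using sub E by (auto intro: sublevel_fmeasurable[of _ t0])
  have pw: "((\<lambda>l::real. l ^ DIM('a)) \<longlongrightarrow> 1) (at_left 1)"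
    by (auto intro!: tendsto_eq_intros)
  have ev: "eventually (\<lambda>l::real. 0 < l \<and> l < 1) (at_left 1)"
    by (rule eventually_at_leftI[of 0]) auto
  \<comment> \<open>Scaling \<open>t0\<close> down to \<open>l * t0 < t0\<close> gives a level where
    \<open>F\<close> is below \<open>c\<close>.\<close>
  have "F t0 \<le> c"
  proof (rule tendsto_upperbound)
    show "((\<lambda>l. l ^ DIM('a) * F t0) \<longlongrightarrow> F t0) (at_left 1)"
      using tendsto_mult[OF pw tendsto_const[of "F t0"]] by simp
    show "\<forall>\<^sub>F l in at_left 1. l ^ DIM('a) * F t0 \<le> c"
      using ev
    proof eventually_elim
      case (elim l)
      then show ?case using F_scale[of l t0] below[of "l * t0"] t0 by simp
    qed
  qed simp
  then have le: "measure lborel ?E \<le> c"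
    using measure_mono_fmeasurable[OF sub(2), of lborel] E sublevel_fmeasurable[of "{y. V y \<le> t0}" t0]
    by (simp add: F_def)
  \<comment> \<open>Now the level \<open>t0 / l > t0\<close>, where \<open>F\<close> is at least
    \<open>c\<close>, is scaled down to \<open>t0\<close>.\<close>
  have Ft0: "c \<le> F t0"
  proof (rule tendsto_upperbound)
    show "((\<lambda>l. l ^ DIM('a) * c) \<longlongrightarrow> c) (at_left 1)"
      using tendsto_mult[OF pw tendsto_const[of c]] by simp
    show "\<forall>\<^sub>F l in at_left 1. l ^ DIM('a) * c \<le> F t0"
      using ev
    proof eventually_elim
      case (elim l)
      have "l ^ DIM('a) * c \<le> l ^ DIM('a) * F (t0 / l)"
        using elim t0 above[of "t0 / l"] by (intro mult_left_mono) (auto simp: field_simps)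
      also have "\<dots> \<le> F t0" using F_scale[of l "t0 / l"] elim by simp
      finally show ?case .
    qed
  qed simp
  \<comment> \<open>The set contains \<open>{V <= l * t0}\<close> for every \<open>l < 1\<close>,
    and these volumes are at least \<open>l ^ d * c\<close>.\<close>
  have "c \<le> measure lborel ?E"
  proof (rule tendsto_upperbound)
    show "((\<lambda>l. l ^ DIM('a) * c) \<longlongrightarrow> c) (at_left 1)"
      using tendsto_mult[OF pw tendsto_const[of c]] by simp
    show "\<forall>\<^sub>F l in at_left 1. l ^ DIM('a) * c \<le> measure lborel ?E"
      using ev
    proof eventually_elim
      case (elim l)
      have "l ^ DIM('a) * c \<le> l ^ DIM('a) * F t0" using elim Ft0 by (intro mult_left_mono) auto
      also have "\<dots> \<le> F (l * t0)" using F_scale[of l t0] elim by simp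
      also have "F (l * t0) \<le> measure lborel ?E"
        unfolding F_def[of "l * t0"]
      proof (rule measure_mono_fmeasurable[OF _ _ m(1)])
        have "l * t0 < t0" using elim t0 by simp
        then show "{y. V y \<le> l * t0} \<subseteq> ?E" using below by force
      qed simp
      finally show ?case .
    qed
  qed simp
  with le have "measure lborel ?E = c" by simp
  then show "emeasure lborel ?E = ennreal c"
    using m by (simp add: emeasure_eq_measure2)
qed


section \<open>The optimal kernel attached to \<open>V\<close>\<close>

lemma F_zero_less: "r > 0 \<Longrightarrow> F 0 < unit_ball_vol (real DIM('a)) * r ^ DIM('a)"
  using F_small[of r] F_mono[of 0] by (metis less_imp_le order_le_less_trans)

text \<open>
  The value at \<open>y\<close> is \<open>r\<close> to the power \<open>- d - s\<close>, where \<open>r\<close> is the radius of the ball with the volume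
  of \<open>{V \<le> V y}\<close>. At the origin \<open>r = 0\<close>, where \<open>powr\<close> would return \<open>0\<close> instead of \<open>\<infinity>\<close>.
\<close>

definition opt_kernel :: "real \<Rightarrow> 'a \<Rightarrow> ennreal" where
  "opt_kernel s y = (if y = 0 then \<infinity> else
     ennreal ((F (V y) / unit_ball_vol (real DIM('a))) powr (- (real DIM('a) + s) / real DIM('a))))"

lemma opt_kernel_borel [measurable]: "opt_kernel s \<in> borel_measurable borel"
  unfolding opt_kernel_def[abs_def] by measurable

text \<open>The exponent is negative, so a large kernel value means a small rank
  \<open>F (V y)\<close>, and it maps \<open>r ^ d\<close> to the threshold. The origin lies in both
  sets, by the value \<open>\<infinity>\<close> on the left and by \<open>F_zero_less\<close> on the
  right.\<close>

lemma opt_kernel_superlevel: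
  assumes "s > 0" "r > 0"
  shows "{y. opt_kernel s y > ennreal (r powr (- real DIM('a) - s))}
     = {y. F (V y) < unit_ball_vol (real DIM('a)) * r ^ DIM('a)}"
proof -
  let ?w = "unit_ball_vol (real DIM('a))" and ?e = "- (real DIM('a) + s) / real DIM('a)"
  have w: "?w > 0" by simp
  have e: "?e < 0" using assms by (simp add: divide_neg_pos)
  have r: "r powr (- real DIM('a) - s) = (r ^ DIM('a)) powr ?e"
    using assms by (simp add: powr_realpow[symmetric] powr_powr)
  have "opt_kernel s y > ennreal (r powr (- real DIM('a) - s)) \<longleftrightarrow> F (V y) < ?w * r ^ DIM('a)" for y
  proof (cases "y = 0")
    case True
    then show ?thesis using F_zero_less[OF assms(2)] by (simp add: opt_kernel_def V_zero)
  next
    case False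
    define q where "q = F (V y) / ?w"
    have q: "q > 0" using F_pos[OF V_pos[OF False]] w by (simp add: q_def)
    have "(r ^ DIM('a)) powr ?e < q powr ?e \<longleftrightarrow> q < r ^ DIM('a)"
      using powr_less_mono2_neg[OF e q] powr_mono2'[of ?e "r ^ DIM('a)" q] e assms
      by (meson less_imp_le not_le zero_less_power)
    moreover have "q < r ^ DIM('a) \<longleftrightarrow> F (V y) < ?w * r ^ DIM('a)"
      using w by (simp add: q_def field_simps)
    ultimately show ?thesis using False by (simp add: opt_kernel_def r q_def ennreal_less_iff)
  qed
  then show ?thesis by blast
qed

lemma opt_kernel_admissible:
  assumes "s > 0" shows "admissible_kernel s (opt_kernel s)"
  unfolding admissible_kernel_def
proof (intro conjI allI impI)
  show "opt_kernel s \<in> borel_measurable lebesgue" by (intro measurable_completion) simp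
  fix r :: real assume r: "r > 0"
  have "{y. F (V y) < unit_ball_vol (real DIM('a)) * r ^ DIM('a)} \<in> sets borel" by measurable
  then show "emeasure lebesgue {y. ennreal (r powr (- real DIM('a) - s)) < opt_kernel s y}
      = emeasure lebesgue (ball (0::'a) r)"
    unfolding opt_kernel_superlevel[OF assms r]
    using r rank_sublevel(1)[OF r] by (simp add: emeasure_ball)
qed

text \<open>The superlevel set lies between \<open>{V < t}\<close> and \<open>{V <= t}\<close>, so
  \<open>\<phi> (V y)\<close> is at most \<open>\<phi> t\<close> on it and at least
  \<open>\<phi> t\<close> off it. The set does not depend on \<open>\<phi>\<close>, hence one kernel
  serves all monotone \<open>\<phi>\<close>.\<close>

lemma opt_kernel_layer_le:
  fixes \<phi> :: "real \<Rightarrow> real"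
  assumes "s > 0" "r > 0" and "mono \<phi>" and [measurable]: "E' \<in> sets borel"
    and E': "emeasure lborel E' = emeasure lborel (ball (0::'a) r)"
  shows "(\<integral>\<^sup>+y. ennreal (\<phi> (V y)) * indicator {y. ennreal (r powr (- real DIM('a) - s)) < opt_kernel s y} y \<partial>lborel)
     \<le> (\<integral>\<^sup>+y. ennreal (\<phi> (V y)) * indicator E' y \<partial>lborel)"
proof -
  let ?c = "unit_ball_vol (real DIM('a)) * r ^ DIM('a)"
  obtain t where t: "{y. V y < t} \<subseteq> {y. F (V y) < ?c}" "{y. F (V y) < ?c} \<subseteq> {y. V y \<le> t}"
    using rank_sublevel(2)[OF assms(2)] by blast
  have [measurable]: "\<phi> \<in> borel_measurable borel"
    using assms(3) by (rule borel_measurable_mono)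
  show ?thesis unfolding opt_kernel_superlevel[OF assms(1,2)]
  proof (rule nn_integral_bathtub[where c = "ennreal (\<phi> t)"])
    show "emeasure lborel {y. F (V y) < ?c} = emeasure lborel E'"
      using E' rank_sublevel(1)[OF assms(2)] assms(2) by (simp add: emeasure_ball)
    show "emeasure lborel {y. F (V y) < ?c} < \<infinity>"
      using rank_sublevel(1)[OF assms(2)] by simp
    show "ennreal (\<phi> (V y)) \<le> ennreal (\<phi> t)" if "y \<in> {y. F (V y) < ?c}" for y
      using t(2) that by (intro ennreal_leI monoD[OF assms(3)]) auto
    show "ennreal (\<phi> t) \<le> ennreal (\<phi> (V y))" if "y \<notin> {y. F (V y) < ?c}" for y
      using t(1) that by (intro ennreal_leI monoD[OF assms(3)]) (auto simp: not_less[symmetric])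
  qed measurable
qed

text \<open>At each height the two superlevel sets have the same volume, so the layers compare; the
  layer cake formula integrates the comparison.\<close>

lemma opt_kernel_le:
  fixes \<phi> :: "real \<Rightarrow> real"
  assumes "s > 0" and "mono \<phi>" and [measurable]: "K \<in> borel_measurable borel"
    and K: "admissible_kernel s K"
  shows "(\<integral>\<^sup>+y. ennreal (\<phi> (V y)) * opt_kernel s y \<partial>lborel) \<le> (\<integral>\<^sup>+y. ennreal (\<phi> (V y)) * K y \<partial>lborel)"
proof -
  have [measurable]: "\<phi> \<in> borel_measurable borel"
    using assms(2) by (rule borel_measurable_mono)
  have "(\<integral>\<^sup>+y. ennreal (\<phi> (V y)) * indicator {y. ennreal \<tau> < opt_kernel s y} y \<partial>lborel)
     \<le> (\<integral>\<^sup>+y. ennreal (\<phi> (V y)) * indicator {y. ennreal \<tau> < K y} y \<partial>lborel)" if "\<tau> > 0" for \<tau>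
  proof -
    define r where "r = \<tau> powr (- 1 / (real DIM('a) + s))"
    have r: "r > 0" using that by (simp add: r_def)
    have \<tau>: "\<tau> = r powr (- real DIM('a) - s)"
      unfolding r_def using that assms(1) by (intro powr_radius[symmetric]) simp_all
    have E: "{y. ennreal (r powr (- real DIM('a) - s)) < K y} \<in> sets borel" by measurable
    have "emeasure lebesgue {y. ennreal (r powr (- real DIM('a) - s)) < K y} = emeasure lebesgue (ball (0::'a) r)"
      using K r unfolding admissible_kernel_def by blast
    then have "emeasure lborel {y. ennreal (r powr (- real DIM('a) - s)) < K y} = emeasure lborel (ball (0::'a) r)"
      using E by simp
    from opt_kernel_layer_le[OF assms(1) r assms(2) E this]
    show ?thesis unfolding \<tau> .
  qed
  then show ?thesis
    by (subst (1 2) nn_integral_layer_cake) (auto intro!: nn_integral_mono simp: indicator_def)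
qed

text \<open>Each layer is compared with the ball of equal volume, where \<open>V <= B * r^2\<close>.
  The bound \<open>\<eta>\<close> is integrable over small heights because \<open>0 < s\<close>, the
  bound \<open>B * r^2\<close> over large ones because \<open>s < 2\<close>.\<close>

lemma opt_kernel_truncated_le:
  assumes "0 < s" "s < 2" "\<eta> > 0"
  shows "(\<integral>\<^sup>+y. ennreal (min (V y) \<eta>) * opt_kernel s y \<partial>lborel) \<le>
    ennreal (unit_ball_vol (real DIM('a)) * (real DIM('a) + s) * (1 / s + B / (2 - s)) * \<eta> powr (1 - s / 2))"
proof -
  let ?d = "real DIM('a)" let ?w = "unit_ball_vol ?d"
  have d: "?d > 0" by simp
  have w: "?w > 0" by simp
  \<comment> \<open>In terms of the height, \<open>r ^ d\<close> is \<open>\<tau> powr (- p)\<close>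
    and \<open>r ^ (d + 2)\<close> is \<open>\<tau> powr (- q)\<close>, with
    \<open>p < 1 < q\<close>. The height \<open>\<tau>0\<close> belongs to the radius
    \<open>sqrt \<eta>\<close>, where \<open>r^2 = \<eta>\<close>.\<close>
  define p q \<tau>0 where "p = ?d / (?d + s)" and "q = (?d + 2) / (?d + s)" and "\<tau>0 = \<eta> powr (- (?d + s) / 2)"
  have \<tau>0: "\<tau>0 > 0" using assms by (simp add: \<tau>0_def)
  have p: "- p > - 1" "- p + 1 = s / (?d + s)" using assms d by (auto simp: p_def field_simps)
  have q: "- q < - 1" "- q + 1 = - ((2 - s) / (?d + s))" using assms d by (auto simp: q_def field_simps)
  have cancel: "- (?d + s) / 2 * (c / (?d + s)) = - c / 2" for c
  proof -
    have "- X / 2 * (c / X) = - c / 2" if "X > 0" for X :: real using that by simp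
    from this[OF add_pos_pos[OF d assms(1)]] show ?thesis .
  qed
  have \<phi>: "mono (\<lambda>v. min v \<eta>)" by (auto simp: mono_def)
  have layer: "(\<integral>\<^sup>+y. ennreal (min (V y) \<eta>) * indicator {y. ennreal \<tau> < opt_kernel s y} y \<partial>lborel)
    \<le> ennreal (min (B * ?w * \<tau> powr (- q)) (\<eta> * ?w * \<tau> powr (- p)))" if "\<tau> > 0" for \<tau>
  proof -
    define r where "r = \<tau> powr (- 1 / (?d + s))"
    have r: "r > 0" using that by (simp add: r_def)
    have \<tau>: "\<tau> = r powr (- ?d - s)"
      unfolding r_def using that assms(1) by (intro powr_radius[symmetric]) simp_all
    have rd: "r ^ DIM('a) = \<tau> powr (- p)" using r by (simp add: powr_realpow[symmetric] r_def powr_powr p_def)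
    have rd2: "r\<^sup>2 * r ^ DIM('a) = \<tau> powr (- q)"
    proof -
      have "r\<^sup>2 * r ^ DIM('a) = r powr (?d + 2)"
        using r by (simp add: powr_add powr_realpow)
      also have "\<dots> = \<tau> powr (- q)" using that by (simp add: r_def powr_powr q_def)
      finally show ?thesis .
    qed
    have "(\<integral>\<^sup>+y. ennreal (min (V y) \<eta>) * indicator {y. ennreal \<tau> < opt_kernel s y} y \<partial>lborel)
      \<le> (\<integral>\<^sup>+y. ennreal (min (V y) \<eta>) * indicator (ball 0 r) y \<partial>lborel)"
      unfolding \<tau> using opt_kernel_layer_le[OF assms(1) r \<phi>, of "ball 0 r"] by simp
    also have "\<dots> \<le> (\<integral>\<^sup>+y. ennreal (min (B * r\<^sup>2) \<eta>) * indicator (ball (0::'a) r) y \<partial>lborel)"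
    proof (intro nn_integral_mono)
      fix y :: 'a
      have "V y \<le> B * r\<^sup>2" if "norm y < r"
        using upper[of y] B_pos that by (smt (verit) mult_left_mono norm_ge_zero power_mono)
      then show "ennreal (min (V y) \<eta>) * indicator (ball 0 r) y \<le> ennreal (min (B * r\<^sup>2) \<eta>) * indicator (ball 0 r) y"
        by (auto simp: indicator_def min.coboundedI1 intro!: ennreal_leI)
    qed
    also have "\<dots> = ennreal (min (B * r\<^sup>2) \<eta>) * ennreal (?w * r ^ DIM('a))"
      using r by (subst nn_integral_cmult_indicator) (simp, subst emeasure_ball, simp_all)
    also have "\<dots> = ennreal (min (B * r\<^sup>2) \<eta> * (?w * r ^ DIM('a)))"
      using B_pos assms r by (intro ennreal_mult[symmetric]) auto
    also have "min (B * r\<^sup>2) \<eta> * (?w * r ^ DIM('a)) = min (B * r\<^sup>2 * (?w * r ^ DIM('a))) (\<eta> * (?w * r ^ DIM('a)))"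
      using r w by (simp add: min_mult_distrib_right)
    also have "B * r\<^sup>2 * (?w * r ^ DIM('a)) = B * ?w * \<tau> powr (- q)" using rd2 by (simp add: mult_ac)
    also have "\<eta> * (?w * r ^ DIM('a)) = \<eta> * ?w * \<tau> powr (- p)" using rd by simp
    finally show ?thesis .
  qed
  have I1: "(\<integral>\<^sup>+\<tau>. ennreal (\<eta> * ?w * \<tau> powr (- p)) * indicator {0..\<tau>0} \<tau> \<partial>lborel)
     = ennreal (\<eta> * ?w * (\<tau>0 powr (- p + 1) / (- p + 1)))"
    using assms \<tau>0 p(1) w
    by (intro nn_integral_has_integral_lebesgue' has_integral_mult_right has_integral_powr_from_0) auto
  have I2: "(\<integral>\<^sup>+\<tau>. ennreal (B * ?w * \<tau> powr (- q)) * indicator {\<tau>0..} \<tau> \<partial>lborel)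
     = ennreal (B * ?w * (- (\<tau>0 powr (- q + 1)) / (- q + 1)))"
    using B_pos \<tau>0 q(1) w
    by (intro nn_integral_has_integral_lebesgue' has_integral_mult_right has_integral_powr_to_inf) auto
  have "(\<integral>\<^sup>+y. ennreal (min (V y) \<eta>) * opt_kernel s y \<partial>lborel)
    = (\<integral>\<^sup>+\<tau>. (\<integral>\<^sup>+y. ennreal (min (V y) \<eta>) * indicator {y. ennreal \<tau> < opt_kernel s y} y \<partial>lborel) * indicator {0<..} \<tau> \<partial>lborel)"
    by (rule nn_integral_layer_cake) measurable
  \<comment> \<open>Heights up to \<open>\<tau>0\<close> use the truncation level, larger ones the
    quadratic bound; both pieces come out as multiples of
    \<open>\<eta> powr (1 - s / 2)\<close>.\<close>
  also have "\<dots> \<le> (\<integral>\<^sup>+\<tau>. ennreal (\<eta> * ?w * \<tau> powr (- p)) * indicator {0..\<tau>0} \<tau>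
      + ennreal (B * ?w * \<tau> powr (- q)) * indicator {\<tau>0..} \<tau> \<partial>lborel)"
  proof (intro nn_integral_mono)
    fix \<tau> :: real
    show "(\<integral>\<^sup>+y. ennreal (min (V y) \<eta>) * indicator {y. ennreal \<tau> < opt_kernel s y} y \<partial>lborel) * indicator {0<..} \<tau>
      \<le> ennreal (\<eta> * ?w * \<tau> powr (- p)) * indicator {0..\<tau>0} \<tau>
      + ennreal (B * ?w * \<tau> powr (- q)) * indicator {\<tau>0..} \<tau>"
    proof (cases "\<tau> > 0")
      case True
      from layer[OF True]
      have "(\<integral>\<^sup>+y. ennreal (min (V y) \<eta>) * indicator {y. ennreal \<tau> < opt_kernel s y} y \<partial>lborel)
         \<le> ennreal (B * ?w * \<tau> powr (- q))"
        "(\<integral>\<^sup>+y. ennreal (min (V y) \<eta>) * indicator {y. ennreal \<tau> < opt_kernel s y} y \<partial>lborel)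
         \<le> ennreal (\<eta> * ?w * \<tau> powr (- p))"
        by (auto elim!: order_trans intro!: ennreal_leI)
      then show ?thesis using True by (cases "\<tau> \<le> \<tau>0") (auto simp: indicator_def add_increasing2)
    qed simp
  qed
  also have "\<dots> = ennreal (\<eta> * ?w * (\<tau>0 powr (- p + 1) / (- p + 1))) + ennreal (B * ?w * (- (\<tau>0 powr (- q + 1)) / (- q + 1)))"
    by (subst nn_integral_add) (simp_all only: I1 I2, measurable)
  also have "\<tau>0 powr (- p + 1) = \<eta> powr (- s / 2)"
    unfolding \<tau>0_def powr_powr p cancel ..
  also have "\<tau>0 powr (- q + 1) = \<eta> powr (1 - s / 2)"
    unfolding \<tau>0_def powr_powr q mult_minus_right cancel by (simp add: diff_divide_distrib)
  also have "\<eta> * ?w * (\<eta> powr (- s / 2) / (- p + 1)) = ?w * (?d + s) * (1 / s) * \<eta> powr (1 - s / 2)"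
  proof -
    have "\<eta> powr (1 - s / 2) = \<eta> * \<eta> powr (- s / 2)"
      using assms powr_add[of \<eta> 1 "- s / 2"] by simp
    then show ?thesis unfolding p(2) by simp
  qed
  also have "B * ?w * (- (\<eta> powr (1 - s / 2)) / (- q + 1)) = ?w * (?d + s) * (B / (2 - s)) * \<eta> powr (1 - s / 2)"
    unfolding q(2) by simp
  finally show ?thesis
    using assms B_pos w by (simp add: ennreal_plus[symmetric] algebra_simps del: ennreal_plus)
qed

end

section \<open>Translated competitors\<close>

lemma nn_integral_lborel_translate:
  fixes f :: "'a::euclidean_space \<Rightarrow> ennreal"
  assumes [measurable]: "f \<in> borel_measurable borel"
  shows "(\<integral>\<^sup>+y. f (y + h) \<partial>lborel) = (\<integral>\<^sup>+y. f y \<partial>lborel)"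
proof -
  have "(\<integral>\<^sup>+y. f y \<partial>lborel) = (\<integral>\<^sup>+y. f y \<partial>distr lborel borel ((+) h))"
    by (simp add: lborel_distr_plus)
  also have "\<dots> = (\<integral>\<^sup>+y. f (h + y) \<partial>lborel)" by (rule nn_integral_distr) simp_all
  finally show ?thesis by (simp add: add.commute)
qed

lemma admissible_kernel_translate:
  fixes K :: "'a::euclidean_space \<Rightarrow> ennreal"
  assumes [measurable]: "K \<in> borel_measurable borel" and K: "admissible_kernel s K"
  shows "admissible_kernel s (\<lambda>y. K (y + h))"
  unfolding admissible_kernel_def
proof (intro conjI allI impI)
  show "(\<lambda>y. K (y + h)) \<in> borel_measurable lebesgue" by (intro measurable_completion) simp
  fix r :: real assume r: "r > 0"
  let ?c = "ennreal (r powr (- real DIM('a) - s))"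
  have [measurable]: "{y. ?c < K (y + h)} \<in> sets borel" "{y. ?c < K y} \<in> sets borel" by measurable
  have "emeasure lborel {y. ?c < K (y + h)} = (\<integral>\<^sup>+y. indicator {y. ?c < K y} (y + h) \<partial>lborel)"
    by (simp add: nn_integral_indicator[symmetric] indicator_def del: nn_integral_indicator)
  also have "\<dots> = emeasure lborel {y. ?c < K y}"
    by (subst nn_integral_lborel_translate) simp_all
  finally show "emeasure lebesgue {y. ?c < K (y + h)} = emeasure lebesgue (ball (0::'a) r)"
    using K r unfolding admissible_kernel_def by simp
qed

text \<open>The shift \<open>h\<close> accounts for \<open>V\<close> and \<open>w\<close> being
  centred at different points. The optimal kernel pays the truncation bound for
  \<open>min V \<eta>\<close>, and for the excess over \<open>\<eta>\<close> it does no worse than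
  the shifted \<open>K\<close>.\<close>

lemma (in starshaped_growth) exists_kernel_le:
  fixes w :: "'a \<Rightarrow> real"
  assumes s: "0 < s" "s < 2" and \<eta>: "\<eta> > 0" and A: "A \<ge> 0"
    and [measurable]: "w \<in> borel_measurable borel" and w: "\<And>y. w y \<ge> 0"
    and V_le: "\<And>y. V y \<le> \<eta> + A * w (y + h)"
    and K: "admissible_kernel s K"
  shows "\<exists>K'. admissible_kernel s K' \<and> (\<integral>\<^sup>+y. ennreal (V y) * K' y \<partial>lebesgue) \<le>
     ennreal (unit_ball_vol (real DIM('a)) * (real DIM('a) + s) * (1 / s + B / (2 - s)) * \<eta> powr (1 - s / 2))
     + ennreal A * (\<integral>\<^sup>+y. ennreal (w y) * K y \<partial>lebesgue)"
proof (intro exI conjI)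
  show "admissible_kernel s (opt_kernel s)" using s(1) by (rule opt_kernel_admissible)
  obtain K1 where [measurable]: "K1 \<in> borel_measurable borel"
    and K1: "admissible_kernel s K1" "AE y in lborel. K y = K1 y"
    using admissible_kernel_borel_version[OF K] .
  \<comment> \<open>Since \<open>ennreal\<close> sends negative reals to 0, \<open>?\<psi>\<close>
    is the positive part of \<open>v - \<eta>\<close>.\<close>
  let ?K2 = "\<lambda>y. K1 (y + h)" and ?\<psi> = "\<lambda>v. ennreal (v - \<eta>)"
  have "(\<integral>\<^sup>+y. ennreal (V y) * opt_kernel s y \<partial>lborel)
     = (\<integral>\<^sup>+y. ennreal (min (V y) \<eta>) * opt_kernel s y + ?\<psi> (V y) * opt_kernel s y \<partial>lborel)"
  proof (intro nn_integral_cong)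
    fix y
    have "ennreal (V y) = ennreal (min (V y) \<eta>) + ?\<psi> (V y)"
      using V_nonneg[of y] \<eta> by (cases "V y \<le> \<eta>") (auto simp: ennreal_neg ennreal_plus[symmetric] simp del: ennreal_plus)
    then show "ennreal (V y) * opt_kernel s y = ennreal (min (V y) \<eta>) * opt_kernel s y + ?\<psi> (V y) * opt_kernel s y"
      by (simp add: distrib_right)
  qed
  also have "\<dots> = (\<integral>\<^sup>+y. ennreal (min (V y) \<eta>) * opt_kernel s y \<partial>lborel) + (\<integral>\<^sup>+y. ?\<psi> (V y) * opt_kernel s y \<partial>lborel)"
    by (rule nn_integral_add) measurable
  also have "(\<integral>\<^sup>+y. ?\<psi> (V y) * opt_kernel s y \<partial>lborel) \<le> (\<integral>\<^sup>+y. ?\<psi> (V y) * ?K2 y \<partial>lborel)"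
  proof (rule opt_kernel_le[OF s(1)])
    show "mono (\<lambda>v. v - \<eta>)" by (auto simp: mono_def)
    show "admissible_kernel s ?K2" using K1 by (intro admissible_kernel_translate) simp_all
  qed measurable
  also have "\<dots> \<le> (\<integral>\<^sup>+y. ennreal A * (ennreal (w (y + h)) * K1 (y + h)) \<partial>lborel)"
  proof (intro nn_integral_mono)
    fix y
    have "?\<psi> (V y) \<le> ennreal (A * w (y + h))" using V_le[of y] by (intro ennreal_leI) simp
    also have "\<dots> = ennreal A * ennreal (w (y + h))" using A w by (rule ennreal_mult)
    finally show "?\<psi> (V y) * ?K2 y \<le> ennreal A * (ennreal (w (y + h)) * K1 (y + h))"
      by (simp add: mult.assoc[symmetric] mult_right_mono)
  qed
  also have "\<dots> = ennreal A * (\<integral>\<^sup>+y. ennreal (w y) * K1 y \<partial>lborel)"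
    using nn_integral_lborel_translate[of "\<lambda>y. ennreal (w y) * K1 y" h] by (simp add: nn_integral_cmult)
  also have "(\<integral>\<^sup>+y. ennreal (w y) * K1 y \<partial>lborel) = (\<integral>\<^sup>+y. ennreal (w y) * K y \<partial>lborel)"
    using K1(2) by (intro nn_integral_cong_AE) (auto elim!: eventually_mono)
  finally show "(\<integral>\<^sup>+y. ennreal (V y) * opt_kernel s y \<partial>lebesgue) \<le>
     ennreal (unit_ball_vol (real DIM('a)) * (real DIM('a) + s) * (1 / s + B / (2 - s)) * \<eta> powr (1 - s / 2))
     + ennreal A * (\<integral>\<^sup>+y. ennreal (w y) * K y \<partial>lebesgue)"
    using opt_kernel_truncated_le[OF s \<eta>]
    by (simp add: nn_integral_completion add_mono order_trans)
qed



section \<open>Gradient and tangent gap of a convex function\<close>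

lemma gderiv_gradient:
  fixes u :: "'a::euclidean_space \<Rightarrow> real"
  assumes "u differentiable (at x)"
  shows "GDERIV u x :> gradient u x"
proof -
  obtain u' where u': "(u has_derivative u') (at x)" using assms unfolding differentiable_def by blast
  interpret u': bounded_linear u' by (rule has_derivative_bounded_linear[OF u'])
  \<comment> \<open>The vector representing the derivative. Its uniqueness, shown below, justifies
    the \<open>THE\<close> in \<open>gradient\<close>.\<close>
  define D where "D = (\<Sum>i\<in>Basis. u' i *\<^sub>R i)"
  have "u' h = h \<bullet> D" for h
  proof -
    have "u' h = u' (\<Sum>i\<in>Basis. (h \<bullet> i) *\<^sub>R i)" by (simp add: euclidean_representation)
    also have "\<dots> = h \<bullet> D" by (simp add: u'.sum u'.scaleR D_def inner_sum_right mult.commute)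
    finally show ?thesis .
  qed
  then have "u' = (\<lambda>h. h \<bullet> D)" by (rule ext)
  then have D: "GDERIV u x :> D" using u' by (simp add: gderiv_def)
  have "D' = D" if "GDERIV u x :> D'" for D'
  proof -
    have "(\<lambda>h. h \<bullet> D') = (\<lambda>h. h \<bullet> D)"
      using that D unfolding gderiv_def by (rule has_derivative_unique)
    then have "h \<bullet> D' = h \<bullet> D" for h by metis
    then show ?thesis by (metis vector_eq_ldot)
  qed
  with D show ?thesis unfolding gradient_def by (rule theI)
qed

text \<open>The argument is the endpoint \<open>p\<close>, not the displacement, so that gaps at two
  base points can be compared at the same point.\<close>

definition tangent_gap :: "('a::euclidean_space \<Rightarrow> real) \<Rightarrow> 'a \<Rightarrow> 'a \<Rightarrow> real" where
  "tangent_gap u x p = u p - u x - (p - x) \<bullet> gradient u x"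

lemma tangent_gap_base_change:
  "tangent_gap u x p = tangent_gap u z p + tangent_gap u x z + (p - z) \<bullet> (gradient u z - gradient u x)"
  by (simp add: tangent_gap_def algebra_simps)

lemma MA_tangent_gap:
  "MA s u x = (INF K\<in>{K. admissible_kernel s K}. \<integral>\<^sup>+ y. ennreal (tangent_gap u x (x + y)) * K y \<partial>lebesgue)"
  by (simp add: MA_def tangent_gap_def)

locale convex_lipschitz_gradient =
  fixes u :: "'a::euclidean_space \<Rightarrow> real" and L :: real
  assumes convex: "convex_on UNIV u"
    and diff: "\<And>x. u differentiable (at x)"
    and lipschitz: "L-lipschitz_on UNIV (gradient u)"
begin

lemma L_nonneg: "L \<ge> 0"
  using lipschitz by (rule lipschitz_on_nonneg)

lemma gradient_dist: "norm (gradient u x - gradient u y) \<le> L * norm (x - y)"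
  using lipschitz_onD[OF lipschitz, of x y] by (simp add: dist_norm)

lemma tangent_gap_borel: "(\<lambda>p. tangent_gap u x p) \<in> borel_measurable borel"
proof -
  have "continuous_on UNIV u"
    using diff by (simp add: continuous_on_eq_continuous_at differentiable_imp_continuous_within)
  then show ?thesis unfolding tangent_gap_def
    by (intro borel_measurable_continuous_onI continuous_intros) auto
qed

lemma tangent_gap_star:
  assumes "0 \<le> l" "l \<le> 1"
  shows "tangent_gap u x (x + l *\<^sub>R y) \<le> l * tangent_gap u x (x + y)"
proof -
  have "u ((1 - l) *\<^sub>R x + l *\<^sub>R (x + y)) \<le> (1 - l) * u x + l * u (x + y)"
    using convex_onD[OF convex, of l x "x + y"] assms by simp
  moreover have "(1 - l) *\<^sub>R x + l *\<^sub>R (x + y) = x + l *\<^sub>R y" by (simp add: algebra_simps)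
  ultimately show ?thesis by (simp add: tangent_gap_def algebra_simps)
qed

text \<open>Restricted to the line through \<open>x\<close> and \<open>p\<close>, \<open>u\<close>
  is a convex function of one variable and lies above its tangent at 0.\<close>

lemma tangent_gap_nonneg: "0 \<le> tangent_gap u x p"
proof -
  let ?\<phi> = "\<lambda>t. u (x + t *\<^sub>R (p - x))"
  have "convex_on UNIV ?\<phi>"
  proof (rule convex_onI)
    fix t a b :: real assume t: "0 < t" "t < 1"
    have "x + ((1 - t) *\<^sub>R a + t *\<^sub>R b) *\<^sub>R (p - x)
      = (1 - t) *\<^sub>R (x + a *\<^sub>R (p - x)) + t *\<^sub>R (x + b *\<^sub>R (p - x))"
      by (simp add: algebra_simps)
    then show "?\<phi> ((1 - t) *\<^sub>R a + t *\<^sub>R b) \<le> (1 - t) * ?\<phi> a + t * ?\<phi> b"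
      using convex_onD[OF convex, of t "x + a *\<^sub>R (p - x)" "x + b *\<^sub>R (p - x)"] t by simp
  qed simp
  moreover have "(?\<phi> has_field_derivative (p - x) \<bullet> gradient u x) (at 0 within UNIV)"
  proof -
    have g: "(u has_derivative (\<lambda>h. h \<bullet> gradient u x)) (at (x + 0 *\<^sub>R (p - x)))"
      using gderiv_gradient[OF diff, of x] by (simp add: gderiv_def)
    have "((\<lambda>t::real. x + t *\<^sub>R (p - x)) has_derivative (\<lambda>t. t *\<^sub>R (p - x))) (at 0)"
      by (auto intro!: derivative_eq_intros)
    from has_derivative_compose[OF this g] show ?thesis
      by (simp add: has_field_derivative_def mult_commute_abs)
  qed
  ultimately have "((p - x) \<bullet> gradient u x) * (1 - 0) \<le> ?\<phi> 1 - ?\<phi> 0"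
    by (intro convex_on_imp_above_tangent[of UNIV]) auto
  then show ?thesis by (simp add: tangent_gap_def)
qed

text \<open>The gaps from \<open>x\<close> to \<open>p\<close> and from \<open>p\<close> to
  \<open>x\<close> add up to \<open>(p - x) \<bullet> (gradient u p - gradient u x)\<close>, and the
  second is nonnegative.\<close>

lemma tangent_gap_le: "tangent_gap u x p \<le> L * (norm (p - x))\<^sup>2"
proof -
  have "tangent_gap u x p \<le> (p - x) \<bullet> (gradient u p - gradient u x)"
    using tangent_gap_nonneg[of p x] by (simp add: tangent_gap_def algebra_simps)
  also have "\<dots> \<le> norm (p - x) * norm (gradient u p - gradient u x)" by (rule norm_cauchy_schwarz)
  also have "\<dots> \<le> norm (p - x) * (L * norm (p - x))" by (intro mult_left_mono gradient_dist) simp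
  finally show ?thesis by (simp add: power2_eq_square mult_ac)
qed

text \<open>If the section lies in the ball of radius \<open>R\<close>, the gap exceeds
  \<open>\<epsilon>\<close> on its boundary sphere, and star-shapedness carries the slope
  \<open>\<epsilon> / R\<close> outwards along rays.\<close>

lemma tangent_gap_coercive:
  assumes "\<epsilon> > 0" "bounded (graph_section u x0 \<epsilon>)"
  obtains c where "c > 0" "\<And>p. c * norm (p - x0) - \<epsilon> \<le> tangent_gap u x0 p"
proof -
  obtain R where R: "R > 0" "graph_section u x0 \<epsilon> \<subseteq> ball x0 R"
    using bounded_subset_ballD[OF assms(2), of x0] by blast
  have "\<epsilon> / R * norm (p - x0) - \<epsilon> \<le> tangent_gap u x0 p" for p
  proof (cases "norm (p - x0) \<le> R")
    case True
    then have "\<epsilon> / R * norm (p - x0) \<le> \<epsilon>"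
      using R assms by (simp add: field_simps)
    then show ?thesis using tangent_gap_nonneg[of x0 p] by simp
  next
    case False
    define n l where "n = norm (p - x0)" and "l = R / n"
    have n: "n > R" "n > 0" using False R by (auto simp: n_def)
    have l: "0 < l" "l \<le> 1" using n R by (auto simp: l_def)
    have "norm (l *\<^sub>R (p - x0)) = R" using n R by (simp add: l_def n_def)
    then have "x0 + l *\<^sub>R (p - x0) \<notin> ball x0 R" by (simp add: dist_norm)
    then have "x0 + l *\<^sub>R (p - x0) \<notin> graph_section u x0 \<epsilon>" using R by blast
    then have "\<epsilon> < tangent_gap u x0 (x0 + l *\<^sub>R (p - x0))"
      by (simp add: graph_section_def tangent_gap_def)
    also have "\<dots> \<le> l * tangent_gap u x0 p"
      using tangent_gap_star[of l x0 "p - x0"] l by simp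
    finally have "\<epsilon> / R * n \<le> tangent_gap u x0 p"
      using n R by (simp add: l_def field_simps)
    then show ?thesis using assms by (simp add: n_def)
  qed
  moreover have "\<epsilon> / R > 0" using assms R by simp
  ultimately show thesis using that by blast
qed

text \<open>Moving the base point from \<open>x0\<close> to \<open>z\<close> tilts the tangent plane
  by at most \<open>L * norm (z - x0) <= c / 2\<close>, so half of the slope survives.\<close>

lemma tangent_gap_coercive_nearby:
  assumes c: "c > 0" "\<And>p. c * norm (p - x0) - \<epsilon> \<le> tangent_gap u x0 p" and "\<epsilon> > 0"
    and z: "norm (z - x0) \<le> 1" "L * norm (z - x0) \<le> c / 2"
  shows "norm (p - z) \<le> (2 / c + 2 * \<epsilon> / c + 1) * (1 + tangent_gap u z p)"
proof -
  let ?n = "norm (p - x0)" and ?g = "tangent_gap u z p"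
  have g: "?g \<ge> 0" by (rule tangent_gap_nonneg)
  have "norm (gradient u x0 - gradient u z) \<le> c / 2"
    using gradient_dist[of x0 z] z by (simp add: norm_minus_commute)
  then have "- ((p - x0) \<bullet> (gradient u x0 - gradient u z)) \<le> ?n * (c / 2)"
    using norm_cauchy_schwarz[of "- (p - x0)" "gradient u x0 - gradient u z"]
    by (smt (verit) inner_minus_left mult_left_mono norm_ge_zero norm_minus_cancel)
  then have "c / 2 * ?n - \<epsilon> \<le> ?g"
    using c(2)[of p] tangent_gap_nonneg[of z x0]
      tangent_gap_base_change[of u z p x0] by (simp add: field_simps)
  then have "?n \<le> 2 / c * ?g + 2 * \<epsilon> / c" using c(1) by (simp add: field_simps)
  moreover have "norm (p - z) \<le> ?n + 1"
    using norm_triangle_ineq4[of "p - x0" "z - x0"] z by simp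
  moreover have "2 / c * ?g + 2 * \<epsilon> / c + 1 \<le> (2 / c + 2 * \<epsilon> / c + 1) * (1 + ?g)"
  proof -
    have "0 \<le> 2 / c + (2 * \<epsilon> / c) * ?g + ?g" using g c(1) \<open>\<epsilon> > 0\<close> by simp
    then show ?thesis by (simp only: distrib_left distrib_right)
  qed
  ultimately show ?thesis by simp
qed

section \<open>Comparison of \<open>MA\<close> at two nearby points\<close>

lemma MA_compare:
  assumes s: "0 < s" "s < 2" and D: "D \<ge> 0" "\<And>p. norm (p - z) \<le> D * (1 + tangent_gap u z p)"
    and \<delta>: "\<delta> = norm (x - z)" "0 < \<delta>" "\<delta> \<le> 1"
    and C: "C = (L + 1) * (1 + D)"
    and fin: "MA s u z = ennreal m" "m \<ge> 0"
  shows "MA s u x \<le> ennreal (unit_ball_vol (real DIM('a)) * (real DIM('a) + s) * (1 / s + (L + 1) / (2 - s))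
      * (C * \<delta>) powr (1 - s / 2) + (1 + C * \<delta>) * m)"
proof -
  \<comment> \<open>The added term is quadratic near 0, which keeps \<open>V\<close> below
    \<open>(L + 1) * (norm y)^2\<close>, and linear at infinity, where the growth of the gap at
    \<open>z\<close> absorbs it.\<close>
  define V where "V y = tangent_gap u x (x + y) + \<delta> * min (norm y) ((norm y)\<^sup>2)" for y
  have L: "L \<ge> 0" by (rule L_nonneg)
  have C_pos: "C > 0" using L D unfolding C by (intro mult_pos_pos) auto
  interpret V: starshaped_growth V \<delta> "L + 1"
  proof
    show "V \<in> borel_measurable borel"
      unfolding V_def[abs_def] using tangent_gap_borel[of x] by measurable
    show "V (l *\<^sub>R y) \<le> l * V y" if l: "0 \<le> l" "l \<le> 1" for l y
    proof -
      have "l\<^sup>2 \<le> l" using l by (simp add: power2_eq_square mult_left_le)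
      then have "min (l * norm y) (l\<^sup>2 * (norm y)\<^sup>2) \<le> min (l * norm y) (l * (norm y)\<^sup>2)"
        by (intro min.mono mult_right_mono) auto
      also have "\<dots> = l * min (norm y) ((norm y)\<^sup>2)" using l by (simp add: min_mult_distrib_left)
      finally have "\<delta> * min (l * norm y) (l\<^sup>2 * (norm y)\<^sup>2) \<le> \<delta> * (l * min (norm y) ((norm y)\<^sup>2))"
        using \<delta> by (intro mult_left_mono) auto
      then show ?thesis using tangent_gap_star[OF l, of x y] l
        by (simp add: V_def power_mult_distrib distrib_left mult_ac)
    qed
    show "\<delta> * min (norm y) ((norm y)\<^sup>2) \<le> V y" for y
      using tangent_gap_nonneg[of x "x + y"] by (simp add: V_def)
    show "V y \<le> (L + 1) * (norm y)\<^sup>2" for y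
    proof -
      have "\<delta> * min (norm y) ((norm y)\<^sup>2) \<le> 1 * (norm y)\<^sup>2" using \<delta> by (intro mult_mono) auto
      then show ?thesis using tangent_gap_le[of x "x + y"] by (simp add: V_def distrib_right)
    qed
  qed (use \<delta> L in auto)
  let ?w = "\<lambda>y. tangent_gap u z (z + y)"
  have V_le: "V y \<le> C * \<delta> + (1 + C * \<delta>) * ?w (y + (x - z))" for y
  proof -
    define p g where "p = x + y" and "g = tangent_gap u z p"
    have g0: "g \<ge> 0" by (simp add: g_def tangent_gap_nonneg)
    have w: "?w (y + (x - z)) = g" by (simp add: g_def p_def algebra_simps)
    have 1: "tangent_gap u x z \<le> L * \<delta>"
    proof -
      have "tangent_gap u x z \<le> L * \<delta>\<^sup>2"
        using tangent_gap_le[of x z] by (simp add: \<delta> norm_minus_commute)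
      also have "\<dots> \<le> L * \<delta>"
        using \<delta>(2,3) L by (intro mult_left_mono) (auto simp: power2_eq_square mult_left_le)
      finally show ?thesis .
    qed
    have 2: "(p - z) \<bullet> (gradient u z - gradient u x) \<le> norm (p - z) * (L * \<delta>)"
    proof -
      have "(p - z) \<bullet> (gradient u z - gradient u x) \<le> norm (p - z) * norm (gradient u z - gradient u x)"
        by (rule norm_cauchy_schwarz)
      also have "\<dots> \<le> norm (p - z) * (L * \<delta>)"
        using gradient_dist[of z x] by (intro mult_left_mono) (auto simp: \<delta> norm_minus_commute)
      finally show ?thesis .
    qed
    have 3: "\<delta> * min (norm y) ((norm y)\<^sup>2) \<le> \<delta> * (norm (p - z) + 1)"
    proof (rule mult_left_mono)
      have "norm y \<le> norm (p - z) + norm (x - z)"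
        using norm_triangle_ineq4[of "p - z" "x - z"] by (simp add: p_def)
      then show "min (norm y) ((norm y)\<^sup>2) \<le> norm (p - z) + 1" using \<delta> by (simp add: min.coboundedI1)
    qed (use \<delta> in simp)
    have "V y \<le> g + L * \<delta> + norm (p - z) * (L * \<delta>) + \<delta> * (norm (p - z) + 1)"
      using 1 2 3 tangent_gap_base_change[of u x p z] by (simp add: V_def p_def g_def)
    also have "\<dots> = g + (L + 1) * \<delta> * (1 + norm (p - z))" by (simp add: algebra_simps)
    also have "\<dots> \<le> g + (L + 1) * \<delta> * ((1 + D) * (1 + g))"
    proof -
      have "1 + norm (p - z) \<le> (1 + D) * (1 + g)"
        using D(2)[of p] g0 by (simp add: g_def algebra_simps)
      then show ?thesis using L \<delta> by (intro add_left_mono mult_left_mono) auto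
    qed
    also have "\<dots> = C * \<delta> + (1 + C * \<delta>) * g" by (simp add: C algebra_simps)
    finally show ?thesis unfolding w .
  qed
  define a where "a = unit_ball_vol (real DIM('a)) * (real DIM('a) + s) * (1 / s + (L + 1) / (2 - s))
      * (C * \<delta>) powr (1 - s / 2)"
  have a: "a \<ge> 0" unfolding a_def using s L by (intro mult_nonneg_nonneg add_nonneg_nonneg) auto
  have A: "1 + C * \<delta> > 0" using C_pos \<delta> by (simp add: add_pos_pos)
  \<comment> \<open>The infimum defining \<open>MA s u z\<close> need not be attained, so a kernel
    within \<open>e\<close> of it is used.\<close>
  have approx: "MA s u x \<le> ennreal (a + (1 + C * \<delta>) * (m + e))" if "e > 0" for e
  proof -
    have "MA s u z < ennreal (m + e)" using fin that by (simp add: ennreal_less_iff)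
    then obtain K where K: "admissible_kernel s K" "(\<integral>\<^sup>+y. ennreal (?w y) * K y \<partial>lebesgue) < ennreal (m + e)"
      unfolding MA_tangent_gap INF_less_iff by blast
    have "?w \<in> borel_measurable borel"
      by (rule measurable_compose[OF _ tangent_gap_borel]) simp
    then obtain K' where K': "admissible_kernel s K'"
      "(\<integral>\<^sup>+y. ennreal (V y) * K' y \<partial>lebesgue) \<le> ennreal a + ennreal (1 + C * \<delta>) * (\<integral>\<^sup>+y. ennreal (?w y) * K y \<partial>lebesgue)"
      using V.exists_kernel_le[OF s _ _ _ _ V_le K(1)] C_pos \<delta> A tangent_gap_nonneg
      unfolding a_def by (auto simp: less_imp_le)
    have "MA s u x \<le> (\<integral>\<^sup>+y. ennreal (tangent_gap u x (x + y)) * K' y \<partial>lebesgue)"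
      unfolding MA_tangent_gap using K'(1) by (intro INF_lower) simp
    also have "\<dots> \<le> (\<integral>\<^sup>+y. ennreal (V y) * K' y \<partial>lebesgue)"
      using \<delta> by (intro nn_integral_mono mult_right_mono ennreal_leI) (auto simp: V_def)
    also have "\<dots> \<le> ennreal a + ennreal (1 + C * \<delta>) * ennreal (m + e)"
      using K(2) by (intro order_trans[OF K'(2)] add_left_mono mult_left_mono) auto
    also have "\<dots> = ennreal (a + (1 + C * \<delta>) * (m + e))"
      using a A fin that by (simp add: ennreal_mult ennreal_plus)
    finally show ?thesis .
  qed
  \<comment> \<open>The case \<open>e = 1\<close> already shows that \<open>MA s u x\<close> is
    finite.\<close>
  then obtain b where b: "MA s u x = ennreal b" "b \<ge> 0"
    by (metis ennreal_cases ennreal_less_top less_numeral_extra(1) linorder_not_less)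
  have "b \<le> a + (1 + C * \<delta>) * m"
  proof (rule field_le_epsilon)
    fix e :: real assume "e > 0"
    \<comment> \<open>Dividing by \<open>1 + C * \<delta>\<close> makes the final error exactly
      \<open>e\<close>.\<close>
    then have "MA s u x \<le> ennreal (a + (1 + C * \<delta>) * (m + e / (1 + C * \<delta>)))" using A by (intro approx) simp
    then have "b \<le> a + (1 + C * \<delta>) * (m + e / (1 + C * \<delta>))"
      using a A fin \<open>e > 0\<close> unfolding b by (subst (asm) ennreal_le_iff) auto
    also have "\<dots> = a + (1 + C * \<delta>) * m + e" using A by (simp add: distrib_left)
    finally show "b \<le> a + (1 + C * \<delta>) * m + e" .
  qed
  then show ?thesis using b by (simp add: a_def ennreal_leI)
qed

end

section \<open>The Hoelder estimate near \<open>x0\<close>\<close>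

theorem corollary4p7:
  fixes u :: "'a::euclidean_space \<Rightarrow> real"
    and x0 :: 'a
    and s \<epsilon> \<Lambda> :: real
  assumes "1 < s" and "s < 2"
    and "\<epsilon> > 0"
    and "convex_on UNIV u"
    and "C11 u"
    and "\<exists>N. \<exists>M::real. open N \<and> x0 \<in> N \<and> (\<forall>x\<in>N. MA s u x \<le> ennreal M)"
    and "bounded (graph_section u x0 \<epsilon>)"
    and "diameter (graph_section u x0 \<epsilon>) = \<Lambda>"
  shows "\<exists>N. open N \<and> x0 \<in> N \<and> (\<forall>x\<in>N. MA s u x < \<infinity>)
           \<and> holder_on (1 - s / 2) N (\<lambda>x. enn2real (MA s u x))"
proof -
  obtain L where "\<And>x. u differentiable (at x)" "L-lipschitz_on UNIV (gradient u)"
    using \<open>C11 u\<close> unfolding C11_def by blast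
  then interpret convex_lipschitz_gradient u L using \<open>convex_on UNIV u\<close> by unfold_locales
  have L: "L \<ge> 0" by (rule L_nonneg)
  obtain N M' where N: "open N" "x0 \<in> N" "\<And>x. x \<in> N \<Longrightarrow> MA s u x \<le> ennreal M'"
    using assms(6) by blast
  \<comment> \<open>\<open>M'\<close> may be negative, in which case \<open>ennreal M'\<close> is
    0.\<close>
  define M where "M = max M' 0"
  have M: "M \<ge> 0" "\<And>x. x \<in> N \<Longrightarrow> MA s u x \<le> ennreal M"
    unfolding M_def by (simp, intro order_trans[OF N(3)] ennreal_leI) auto
  obtain c where c: "c > 0" "\<And>p. c * norm (p - x0) - \<epsilon> \<le> tangent_gap u x0 p"
    using tangent_gap_coercive[OF assms(3,7)] by blast
  obtain \<rho>1 where \<rho>1: "\<rho>1 > 0" "ball x0 \<rho>1 \<subseteq> N" using N openE by blast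
  \<comment> \<open>The bound 1/2 keeps two points of the ball at distance at most 1. The last bound
    gives \<open>L * norm (z - x0) <= c / 2\<close>; \<open>L + 1\<close> avoids division by
    zero.\<close>
  define \<rho> where "\<rho> = min \<rho>1 (min (1 / 2) (c / (2 * (L + 1))))"
  have \<rho>: "\<rho> > 0" "\<rho> \<le> \<rho>1" "\<rho> \<le> 1 / 2" "\<rho> \<le> c / (2 * (L + 1))"
    unfolding \<rho>_def using \<rho>1(1) c(1) L by (simp, linarith+)
  define D C where "D = 2 / c + 2 * \<epsilon> / c + 1" and "C = (L + 1) * (1 + D)"
  have D0: "D \<ge> 0" using c \<open>\<epsilon> > 0\<close> by (simp add: D_def add_nonneg_nonneg)
  have C0: "C \<ge> 0" using L D0 by (simp add: C_def)
  have D: "norm (p - z) \<le> D * (1 + tangent_gap u z p)" if z: "z \<in> ball x0 \<rho>" for z p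
  proof -
    have n: "norm (z - x0) < \<rho>" using z by (simp add: dist_norm norm_minus_commute)
    have "L * norm (z - x0) \<le> (L + 1) * (c / (2 * (L + 1)))"
      using n \<rho>(4) L by (intro mult_mono) auto
    also have "\<dots> = c / 2" using L by (simp add: divide_simps)
    finally show ?thesis unfolding D_def
      using n \<rho> \<open>\<epsilon> > 0\<close> by (intro tangent_gap_coercive_nearby[OF c]) auto
  qed
  define k where "k = unit_ball_vol (real DIM('a)) * (real DIM('a) + s) * (1 / s + (L + 1) / (2 - s))"
  \<comment> \<open>The first summand comes from the truncated part, the second from the factor
    \<open>1 + C * \<delta>\<close> in front of \<open>m <= M\<close>.\<close>
  define H where "H = k * C powr (1 - s / 2) + C * M"
  have k: "k \<ge> 0" unfolding k_def using assms(1,2) L by (intro mult_nonneg_nonneg add_nonneg_nonneg) auto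
  have H: "H \<ge> 0" using k C0 M by (simp add: H_def)
  have fin: "MA s u x < \<infinity>" if "x \<in> ball x0 \<rho>" for x
  proof -
    have "x \<in> N" using that \<rho> \<rho>1 by auto
    from M(2)[OF this] show ?thesis by (simp add: le_less_trans)
  qed
  have one_sided: "enn2real (MA s u x) - enn2real (MA s u z) \<le> H * dist x z powr (1 - s / 2)"
    if x: "x \<in> ball x0 \<rho>" and z: "z \<in> ball x0 \<rho>" for x z
  proof (cases "x = z")
    case False
    define \<delta> m where "\<delta> = norm (x - z)" and "m = enn2real (MA s u z)"
    have m: "MA s u z = ennreal m" "m \<ge> 0" using fin[OF z] by (simp_all add: m_def)
    have zN: "z \<in> N" using z \<rho> \<rho>1 by auto
    have mM: "m \<le> M" using M(2)[OF zN] m M(1) by (simp add: ennreal_le_iff)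
    have \<delta>: "0 < \<delta>" "\<delta> \<le> 1"
    proof -
      show "0 < \<delta>" using False by (simp add: \<delta>_def)
      have "dist x z < 2 * \<rho>" using x z dist_triangle_half_r[of x0 x "2 * \<rho>" z] by simp
      then show "\<delta> \<le> 1" using \<rho> by (simp add: \<delta>_def dist_norm)
    qed
    have "MA s u x \<le> ennreal (k * (C * \<delta>) powr (1 - s / 2) + (1 + C * \<delta>) * m)"
      unfolding k_def
      by (rule MA_compare[OF _ _ D0 D[OF z] \<delta>_def \<delta> C_def m]) (use assms in auto)
    then have "enn2real (MA s u x) \<le> k * (C * \<delta>) powr (1 - s / 2) + (1 + C * \<delta>) * m"
      using k C0 \<delta> m by (intro enn2real_leI) auto
    then have "enn2real (MA s u x) - m \<le> k * (C * \<delta>) powr (1 - s / 2) + C * \<delta> * m"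
      by (simp add: algebra_simps)
    also have "\<dots> \<le> k * (C powr (1 - s / 2) * \<delta> powr (1 - s / 2)) + C * \<delta> powr (1 - s / 2) * M"
    proof -
      \<comment> \<open>As \<open>\<delta> <= 1\<close>, the linear error is dominated by the
        Hoelder power.\<close>
      have "\<delta> powr 1 \<le> \<delta> powr (1 - s / 2)" using \<delta> assms by (intro powr_mono') auto
      then have "C * \<delta> * m \<le> C * \<delta> powr (1 - s / 2) * M"
        using \<delta> C0 m mM by (intro mult_mono) auto
      then show ?thesis using C0 \<delta> by (simp add: powr_mult)
    qed
    also have "\<dots> = H * dist x z powr (1 - s / 2)" by (simp add: H_def \<delta>_def dist_norm algebra_simps)
    finally show ?thesis by (simp add: m_def)
  qed simp
  have "holder_on (1 - s / 2) (ball x0 \<rho>) (\<lambda>x. enn2real (MA s u x))"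
    unfolding holder_on_def
  proof (intro exI[of _ H] conjI ballI H)
    fix x z assume "x \<in> ball x0 \<rho>" "z \<in> ball x0 \<rho>"
    then show "\<bar>enn2real (MA s u x) - enn2real (MA s u z)\<bar> \<le> H * dist x z powr (1 - s / 2)"
      using one_sided[of x z] one_sided[of z x] by (simp add: abs_le_iff dist_commute)
  qed
  then show ?thesis using \<rho> fin by (intro exI[of _ "ball x0 \<rho>"]) auto
qed

end
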